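(* Let $k$ be a positive integer and $s>0$. There is a bijection between the set $\mathcal{FB}_0(s,k)$ and the set $\mathcal{B}^e(s,k)$.
   Context: A free ballot $(s,k)$-path of height $n$ is a lattice path from $(0,0)$ to $(s,n)$ using up steps $(k/2,1)$, down steps $(k/2,-1)$ and horizontal steps $(\ell,0)$ with $\ell$ an integer, $1\le\ell<k$ (it may go below the $x$-axis); $\mathcal{FB}_n(s,k)$ denotes the set of these. A ballot $(s,k)$-path of height $n$ is such a path that never lies below the $x$-axis. $\mathcal{B}^e(s,k)$ is the set of ballot $(s,k)$-paths of even height (the height being any even $n\ge0$). *)

theory Defs
  imports Complex_Main "HOL-Library.Product_Plus"
begin

text \<open>
  A lattice path starting at the origin is represented by the list of its steps, each step being
  a displacement vector.  The abscissa is real since \<open>k / 2\<close> need not be an integer.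
\<close>

definition steps :: "nat \<Rightarrow> (real \<times> int) set" where
  "steps k = {(real k / 2, 1), (real k / 2, - 1)} \<union> {(of_int l, 0) | l :: int. 1 \<le> l \<and> l < int k}"

definition free_ballot_paths :: "int \<Rightarrow> real \<Rightarrow> nat \<Rightarrow> (real \<times> int) list set" where
  "free_ballot_paths n s k = {p. set p \<subseteq> steps k \<and> sum_list p = (s, n)}"

text \<open>
  Since a path is linear between consecutive vertices, it stays weakly above the x-axis iff all of
  its vertices, i.e. the partial sums of its steps, do.
\<close>

definition ballot_paths :: "int \<Rightarrow> real \<Rightarrow> nat \<Rightarrow> (real \<times> int) list set" where
  "ballot_paths n s k =
     {p \<in> free_ballot_paths n s k. \<forall>j\<le>length p. 0 \<le> snd (sum_list (take j p))}"

definition even_ballot_paths :: "real \<Rightarrow> nat \<Rightarrow> (real \<times> int) list set" where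
  "even_ballot_paths s k = (\<Union>n\<in>{n. 0 \<le> n \<and> even n}. ballot_paths n s k)"

end

theory Submission
  imports Defs
begin

text \<open>
  Turn every down step of a free path that reaches a new minimum into an up step.  If the minimum
  is \<open>- m\<close>, the result never lies below the axis and its final height has grown by \<open>2 * m\<close>.
  Conversely, for \<open>m\<close> at most the final height, the turned steps are recovered as the last
  ascents from \<open>i\<close> to \<open>i + 1\<close> for \<open>i < m\<close>.  A path ending on the axis thus yields final height
  \<open>2 * m\<close>, so that \<open>m\<close> can be read off as half the final height.
\<close>

text \<open>
  The following functions take the steps of a path in reverse order, so that the head of the list
  is the last step and recursion runs over the prefixes of the path.
\<close>

abbreviation height :: "(real \<times> int) list \<Rightarrow> int" where
  "height p \<equiv> snd (sum_list p)"

fun nonneg :: "(real \<times> int) list \<Rightarrow> bool" where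
  "nonneg [] \<longleftrightarrow> True"
| "nonneg (a # p) \<longleftrightarrow> 0 \<le> height (a # p) \<and> nonneg p"

fun depth :: "(real \<times> int) list \<Rightarrow> int" where
  "depth [] = 0"
| "depth (a # p) = max (depth p) (- height (a # p))"

fun lift_path :: "(real \<times> int) list \<Rightarrow> (real \<times> int) list" where
  "lift_path [] = []"
| "lift_path (a # p) =
     (if depth p < - height (a # p) then (fst a, - snd a) else a) # lift_path p"

text \<open>\<open>m\<close> counts the ascents still to be turned. While \<open>m\<close> is at
  most the current height, the test \<open>\<le> m\<close> can only hold with equality, so the first
  match in this backward scan is the last ascent to level \<open>m\<close>.\<close>

fun lower_path :: "int \<Rightarrow> (real \<times> int) list \<Rightarrow> (real \<times> int) list" where
  "lower_path m [] = []"
| "lower_path m (a # q) =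
     (if snd a = 1 \<and> height (a # q) \<le> m then (fst a, - snd a) # lower_path (m - 1) q
      else a # lower_path m q)"

lemma nonneg_rev_iff:
  "nonneg (rev p) \<longleftrightarrow> (\<forall>j\<le>length p. 0 \<le> height (take j p))"
proof (induction p rule: rev_induct)
  case Nil
  show ?case by simp
next
  case (snoc a p)
  have "(\<forall>j\<le>length (p @ [a]). 0 \<le> height (take j (p @ [a]))) \<longleftrightarrow>
        (\<forall>j\<le>length p. 0 \<le> height (take j p)) \<and> 0 \<le> height (p @ [a])"
    by (auto simp: le_Suc_eq)
  then show ?case
    using snoc by (auto simp: add.commute)
qed

lemma depth_nonneg: "0 \<le> depth p"
  by (induction p) auto

lemma depth_ge_height: "- height p \<le> depth p"
  by (cases p) auto

lemma fst_sum_list_lift_path: "fst (sum_list (lift_path p)) = fst (sum_list p)"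
  by (induction p) auto

lemma fst_sum_list_lower_path: "fst (sum_list (lower_path m q)) = fst (sum_list q)"
  by (induction q arbitrary: m) auto

lemma step_cases:
  assumes "a \<in> steps k"
  shows "snd a = 1 \<or> snd a = 0 \<or> snd a = - 1"
  using assms by (auto simp: steps_def)

lemma flip_step:
  assumes "a \<in> steps k"
  shows "(fst a, - snd a) \<in> steps k"
  using assms by (auto simp: steps_def)

lemma set_lift_path: "set p \<subseteq> steps k \<Longrightarrow> set (lift_path p) \<subseteq> steps k"
  by (induction p) (auto dest: flip_step)

lemma set_lower_path: "set q \<subseteq> steps k \<Longrightarrow> set (lower_path m q) \<subseteq> steps k"
  by (induction q arbitrary: m) (auto dest: flip_step)

text \<open>Steps descend by at most one, so a new minimum raises the depth by exactly 1, while
  turning the step that reaches it gains 2 in height.\<close>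

lemma height_lift_path:
  assumes "set p \<subseteq> steps k"
  shows "height (lift_path p) = height p + 2 * depth p"
  using assms
proof (induction p)
  case (Cons a p)
  then show ?case
    using step_cases[of a k] depth_ge_height[of p] by auto
qed simp

lemma nonneg_lift_path:
  assumes "set p \<subseteq> steps k"
  shows "nonneg (lift_path p)"
  using assms
proof (induction p)
  case (Cons a p)
  \<comment> \<open>The lifted height is (height + depth) + depth, a sum of two nonnegative
    terms.\<close>
  have "0 \<le> height (lift_path (a # p))"
    using height_lift_path[OF Cons.prems] depth_ge_height[of "a # p"] depth_nonneg[of "a # p"]
    by linarith
  then show ?case
    using Cons by simp
qed simp

lemma lower_path_lift_path:
  assumes "set p \<subseteq> steps k"
  shows "lower_path (depth p) (lift_path p) = p"
  using assms
proof (induction p)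
  case (Cons a p)
  then have height_lift: "height (lift_path p) = height p + 2 * depth p"
    and IH: "lower_path (depth p) (lift_path p) = p"
    by (auto intro: height_lift_path)
  have a: "snd a = 1 \<or> snd a = 0 \<or> snd a = - 1"
    using Cons.prems step_cases[of a k] by simp
  show ?case
  proof (cases "depth p < - height (a # p)")
    case True
    \<comment> \<open>Only a down step taken at the current minimum can reach a new one; once
      turned, it ends at lifted height exactly \<open>depth p + 1\<close>.\<close>
    then have "snd a = - 1" "depth p = - height p"
      using a depth_ge_height[of p] by auto
    then show ?thesis
      using height_lift IH by (simp add: prod_eq_iff)
  next
    case False
    then have "depth (a # p) = depth p"
      by simp
    \<comment> \<open>The lifted prefix already has height at least \<open>depth p\<close>, so an
      unturned up step ends strictly above that level.\<close>
    moreover have "\<not> (snd a = 1 \<and> height (a # lift_path p) \<le> depth p)"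
      using height_lift depth_ge_height[of p] by simp
    ultimately show ?thesis
      using False IH by auto
  qed
qed simp

text \<open>The depth is carried through the induction because \<open>lift_path\<close> compares
  each new height with the depth of the lowered prefix.\<close>

lemma lift_path_lower_path:
  assumes "set q \<subseteq> steps k" "nonneg q" "0 \<le> m" "m \<le> height q"
  shows "lift_path (lower_path m q) = q \<and> depth (lower_path m q) = m"
  using assms
proof (induction q arbitrary: m)
  case (Cons a q)
  have a: "snd a = 1 \<or> snd a = 0 \<or> snd a = - 1" and q: "set q \<subseteq> steps k"
    using Cons.prems step_cases[of a k] by auto
  have height_lower: "height (lower_path m' q) = height q - 2 * m'"
    if "lift_path (lower_path m' q) = q \<and> depth (lower_path m' q) = m'" for m'
    using that height_lift_path[OF set_lower_path[OF q], of m'] by auto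
  have height_q: "0 \<le> height q"
    using Cons.prems by (cases q) auto
  show ?case
  proof (cases "snd a = 1 \<and> height (a # q) \<le> m")
    case True
    then have h: "m = height q + 1"
      using Cons.prems by simp
    then have IH: "lift_path (lower_path (m - 1) q) = q \<and> depth (lower_path (m - 1) q) = m - 1"
      using Cons height_q by simp
    \<comment> \<open>The turned step ends at \<open>height q - 2 * (m - 1) - 1 = - m\<close>, just
      below the previous depth \<open>m - 1\<close>, so lifting turns it back.\<close>
    then show ?thesis
      using True h height_lower[OF IH] by (auto simp: prod_eq_iff)
  next
    case False
    then have "m \<le> height q"
      using Cons.prems a by auto
    then have IH: "lift_path (lower_path m q) = q \<and> depth (lower_path m q) = m"
      using Cons by simp
    \<comment> \<open>The lowered path ends at \<open>height (a # q) - 2 * m\<close>, which is at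
      least \<open>- m\<close>: no new minimum arises.\<close>
    then show ?thesis
      using False Cons.prems height_lower[OF IH] by auto
  qed
qed simp

lemma free_ballot_paths_iff:
  "p \<in> free_ballot_paths n s k \<longleftrightarrow>
     set (rev p) \<subseteq> steps k \<and> fst (sum_list (rev p)) = s \<and> height (rev p) = n"
  by (auto simp: free_ballot_paths_def sum_list_rev prod_eq_iff)

lemma even_ballot_paths_iff:
  "q \<in> even_ballot_paths s k \<longleftrightarrow>
     set (rev q) \<subseteq> steps k \<and> fst (sum_list (rev q)) = s \<and> nonneg (rev q) \<and>
     0 \<le> height (rev q) \<and> even (height (rev q))"
  by (auto simp: even_ballot_paths_def ballot_paths_def free_ballot_paths_iff nonneg_rev_iff)

theorem theorem2p14:
  fixes k :: nat and s :: real
  assumes "k > 0" and "s > 0"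
  shows "\<exists>f. bij_betw f (free_ballot_paths 0 s k) (even_ballot_paths s k)"
proof
  define f where "f p = rev (lift_path (rev p))" for p
  define g where "g q = rev (lower_path (height (rev q) div 2) (rev q))" for q
  show "bij_betw f (free_ballot_paths 0 s k) (even_ballot_paths s k)"
  proof (rule bij_betw_byWitness[where f' = g])
    show "\<forall>p\<in>free_ballot_paths 0 s k. g (f p) = p"
    proof
      fix p assume "p \<in> free_ballot_paths 0 s k"
      then have p: "set (rev p) \<subseteq> steps k" "height (rev p) = 0"
        by (simp_all only: free_ballot_paths_iff)
      then have "height (lift_path (rev p)) div 2 = depth (rev p)"
        using height_lift_path[OF p(1)] by simp
      then show "g (f p) = p"
        unfolding f_def g_def rev_rev_ident by (simp add: lower_path_lift_path[OF p(1)])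
    qed
    show "\<forall>q\<in>even_ballot_paths s k. f (g q) = q"
    proof
      fix q assume "q \<in> even_ballot_paths s k"
      then have "set (rev q) \<subseteq> steps k" "nonneg (rev q)" "0 \<le> height (rev q)"
        by (simp_all only: even_ballot_paths_iff)
      then have "lift_path (lower_path (height (rev q) div 2) (rev q)) = rev q"
        using lift_path_lower_path[of "rev q" k "height (rev q) div 2"] by linarith
      then show "f (g q) = q"
        unfolding f_def g_def rev_rev_ident by (simp only: rev_rev_ident)
    qed
    show "f ` free_ballot_paths 0 s k \<subseteq> even_ballot_paths s k"
    proof (rule image_subsetI)
      fix p assume "p \<in> free_ballot_paths 0 s k"
      then have p: "set (rev p) \<subseteq> steps k" "fst (sum_list (rev p)) = s" "height (rev p) = 0"
        by (simp_all only: free_ballot_paths_iff)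
      show "f p \<in> even_ballot_paths s k"
        unfolding even_ballot_paths_iff f_def rev_rev_ident
        using set_lift_path[OF p(1)] nonneg_lift_path[OF p(1)] height_lift_path[OF p(1)] p(2,3)
          depth_nonneg[of "rev p"]
        by (simp add: fst_sum_list_lift_path)
    qed
    show "g ` even_ballot_paths s k \<subseteq> free_ballot_paths 0 s k"
    proof (rule image_subsetI)
      fix q assume "q \<in> even_ballot_paths s k"
      then have q: "set (rev q) \<subseteq> steps k" "fst (sum_list (rev q)) = s" "nonneg (rev q)"
          "0 \<le> height (rev q)" "even (height (rev q))"
        by (simp_all only: even_ballot_paths_iff)
      let ?p = "lower_path (height (rev q) div 2) (rev q)"
      have p: "set ?p \<subseteq> steps k"
        using q(1) by (rule set_lower_path)
      have "lift_path ?p = rev q \<and> depth ?p = height (rev q) div 2"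
        using q by (intro lift_path_lower_path) auto
      \<comment> \<open>Lowering subtracts twice \<open>height (rev q) div 2\<close>, which by
        evenness is the whole final height.\<close>
      then have "height ?p = 0"
        using height_lift_path[OF p] q(5) by auto
      then show "g q \<in> free_ballot_paths 0 s k"
        unfolding free_ballot_paths_iff g_def rev_rev_ident
        using p q(2) by (simp add: fst_sum_list_lower_path)
    qed
  qed
qed

end
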